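(* Let $0<\alpha\leq1$ and let $G$ be an $\alpha$-expander on $n$ vertices. Then $|L(G)|=\Omega\left(\frac{\alpha^{3}}{\log(1/\alpha)}\right)n$.
   Context: All graphs are finite and simple. For a graph $G=(V,E)$ and $U\subseteq V$, $N_G(U)=\{v\in V\setminus U: v \text{ has a neighbor in } U\}$. For $\alpha>0$, a graph $G$ on $n$ vertices is an $\alpha$-expander if $|N_G(U)|\geq \alpha|U|$ for every $U\subseteq V$ with $|U|\leq\lceil n/2\rceil$. $L(G)=\{\ell: G \text{ contains a cycle of length } \ell\}$ is the set of cycle lengths of $G$ (length = number of edges). Logarithms are base $2$; the $\Omega$ hides an absolute positive constant independent of $\alpha$, $n$ and $G$.
   Formalization: The logarithm log(1/α) is read as max(1, log₂(1/α)), since the bound is undefined at α=1 and false as α→1, and n ≥ C/α is assumed for an absolute constant C, since stars are small expanders without cycles. *)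

theory Defs
  imports Complex_Main "Graph_Theory.Graph_Theory"
begin

text \<open>
  Finite simple graphs are the members of the locale \<^locale>\<open>graph\<close>: finite symmetric digraphs
  without loops and parallel arcs. An undirected edge is a pair of opposite arcs.
\<close>

definition ext_neighborhood :: "('v, 'e) pre_digraph \<Rightarrow> 'v set \<Rightarrow> 'v set" where
  "ext_neighborhood G U = {v \<in> verts G - U. \<exists>u\<in>U. u \<rightarrow>\<^bsub>G\<^esub> v}"

definition alpha_expander :: "real \<Rightarrow> ('v, 'e) pre_digraph \<Rightarrow> bool" where
  "alpha_expander \<alpha> G \<longleftrightarrow>
     (\<forall>U \<subseteq> verts G. int (card U) \<le> \<lceil>real (card (verts G)) / 2\<rceil> \<longrightarrow>
        real (card (ext_neighborhood G U)) \<ge> \<alpha> * real (card U))"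

text \<open>
  \<^const>\<open>pre_digraph.cycle\<close> is the directed notion, for which going along an edge and back is
  a cycle of length 2. All other cycles of a symmetric loopfree digraph without parallel arcs
  are cycles of the undirected graph, hence the condition on the length.
\<close>

definition cycle_lengths :: "('v, 'e) pre_digraph \<Rightarrow> nat set" where
  "cycle_lengths G = {length p | p. pre_digraph.cycle G p \<and> length p \<ge> 3}"

end

theory Submission
  imports Defs
begin

text \<open>
  Let \<open>P\<close> be a path on about \<open>\<alpha>n/48\<close> vertices, found by depth-first search. Removing \<open>P\<close> and a
  largest badly expanding set \<open>Z\<close> of the rest leaves a large set \<open>W\<close> inducing an expander, and a
  maximal matching between \<open>P\<close> and \<open>W\<close> has \<open>k = \<Omega>(\<alpha>\<^sup>2n)\<close> edges, since the outside neighbours of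
  \<open>Z\<close> and the unmatched part of \<open>P\<close> are matched vertices or among the few neighbours of \<open>Z\<close> in
  \<open>W\<close>. Let \<open>x\<^sub>0y\<^sub>0\<close> be the matching edge that comes first along
  \<open>P\<close>. Every other matching edge \<open>xy\<close> closes a cycle consisting of the segment of \<open>P\<close> from \<open>x\<^sub>0\<close> to
  \<open>x\<close> and a shortest path in \<open>W\<close> from \<open>y\<close> to \<open>y\<^sub>0\<close>. Its length is the distance of \<open>x\<^sub>0\<close> and \<open>x\<close> along
  \<open>P\<close> plus the depth of \<open>y\<close> in the breadth-first search of \<open>W\<close> from \<open>y\<^sub>0\<close>, plus 2, so two such edges
  of equal depth give different lengths. Both the balls around \<open>y\<^sub>0\<close> and their complements grow
  geometrically with ratio \<open>1 + \<alpha>/8\<close>; hence at least \<open>k/2\<close> of the matching edges have one of only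
  \<open>O(log(1/\<alpha>)/\<alpha>)\<close> depths.
\<close>

section \<open>Neighbourhoods, circuits and balls of a relation\<close>

definition nbrs :: "('a \<Rightarrow> 'a \<Rightarrow> bool) \<Rightarrow> 'a set \<Rightarrow> 'a set \<Rightarrow> 'a set" where
  "nbrs E W U = {v \<in> W - U. \<exists>u\<in>U. E u v}"

text \<open>Vertex lists over a bare relation are easy to cut and join; the passage to lists of arcs
  comes at the end.\<close>

definition circuit_lengths :: "('a \<Rightarrow> 'a \<Rightarrow> bool) \<Rightarrow> 'a set \<Rightarrow> nat set" where
  "circuit_lengths E V = {length vs | vs. distinct vs \<and> 3 \<le> length vs \<and> set vs \<subseteq> V \<and>
     successively E vs \<and> E (last vs) (hd vs)}"

fun ball :: "('a \<Rightarrow> 'a \<Rightarrow> bool) \<Rightarrow> 'a set \<Rightarrow> 'a \<Rightarrow> nat \<Rightarrow> 'a set" where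
  "ball E W r 0 = {r}"
| "ball E W r (Suc i) = ball E W r i \<union> nbrs E W (ball E W r i)"

text \<open>Distance from \<open>r\<close> in the graph induced on \<open>W\<close>, meaningful only
  for vertices in some ball.\<close>

definition depth :: "('a \<Rightarrow> 'a \<Rightarrow> bool) \<Rightarrow> 'a set \<Rightarrow> 'a \<Rightarrow> 'a \<Rightarrow> nat" where
  "depth E W r v = (LEAST i. v \<in> ball E W r i)"

lemma finite_nbrs: "finite W \<Longrightarrow> finite (nbrs E W U)"
  by (simp add: nbrs_def)

lemma finite_circuit_lengths:
  assumes "finite V" shows "finite (circuit_lengths E V)"
proof (rule finite_subset)
  show "circuit_lengths E V \<subseteq> {..card V}"
    using card_mono[OF assms] by (auto simp: circuit_lengths_def distinct_card[symmetric])
qed simp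

lemma circuitI:
  "\<lbrakk>distinct vs; 3 \<le> length vs; set vs \<subseteq> V; successively E vs; E (last vs) (hd vs)\<rbrakk>
    \<Longrightarrow> length vs \<in> circuit_lengths E V"
  by (auto simp: circuit_lengths_def)

section \<open>Paths from graph searches\<close>

lemma ball_subset: "r \<in> W \<Longrightarrow> ball E W r i \<subseteq> W"
  by (induction i) (auto simp: nbrs_def)

lemma root_in_ball: "r \<in> ball E W r i"
  by (induction i) auto

lemma ball_mono: "i \<le> j \<Longrightarrow> ball E W r i \<subseteq> ball E W r j"
  by (induction j rule: dec_induct) auto

lemma ball_closed: "u \<in> ball E W r i \<Longrightarrow> E u v \<Longrightarrow> v \<in> W \<Longrightarrow> v \<in> ball E W r (Suc i)"
  by (auto simp: nbrs_def)

lemma in_ball_iff_depth: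
  assumes "v \<in> (\<Union>i. ball E W r i)"
  shows "v \<in> ball E W r i \<longleftrightarrow> depth E W r v \<le> i"
proof
  show "v \<in> ball E W r i \<Longrightarrow> depth E W r v \<le> i"
    by (simp add: depth_def Least_le)
  assume "depth E W r v \<le> i"
  moreover have "v \<in> ball E W r (depth E W r v)"
    unfolding depth_def using assms by (metis (mono_tags, lifting) LeastI UN_E)
  ultimately show "v \<in> ball E W r i" using ball_mono[THEN subsetD] by metis
qed

text \<open>The predecessor \<open>u\<close> of \<open>v\<close> lies in no earlier ball, since
  otherwise \<open>v\<close> would be reached sooner, so the induction hypothesis applies to it.
  Confining its path to the previous ball keeps the list distinct when \<open>v\<close> is
  appended.\<close>

lemma shortest_path:
  assumes "r \<in> W" "v \<in> ball E W r i" "\<And>j. j < i \<Longrightarrow> v \<notin> ball E W r j"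
  shows "\<exists>vs. vs \<noteq> [] \<and> hd vs = r \<and> last vs = v \<and> distinct vs \<and> set vs \<subseteq> ball E W r i \<and>
    length vs = Suc i \<and> successively E vs"
  using assms(2,3)
proof (induction i arbitrary: v)
  case 0
  then show ?case by (intro exI[of _ "[r]"]) auto
next
  case (Suc i)
  from Suc.prems have nv: "v \<notin> ball E W r i" by auto
  with Suc.prems obtain u where u: "u \<in> ball E W r i" "E u v" "v \<in> W"
    by (auto simp: nbrs_def)
  have "u \<notin> ball E W r j" if "j < i" for j
    using ball_closed[of u E W r j v] u Suc.prems(2)[of "Suc j"] that by auto
  from Suc.IH[OF u(1) this] obtain vs where vs: "vs \<noteq> []" "hd vs = r" "last vs = u" "distinct vs"
    "set vs \<subseteq> ball E W r i" "length vs = Suc i" "successively E vs" by auto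
  show ?case
    using vs u nv Suc.prems(1)
    by (intro exI[of _ "vs @ [v]"]) (auto simp: successively_append_iff)
qed

lemma depth_path:
  assumes "r \<in> W" "v \<in> (\<Union>i. ball E W r i)"
  shows "\<exists>vs. vs \<noteq> [] \<and> hd vs = r \<and> last vs = v \<and> distinct vs \<and> set vs \<subseteq> W \<and>
    length vs = Suc (depth E W r v) \<and> successively E vs"
  using shortest_path[OF assms(1), of v E "depth E W r v"] in_ball_iff_depth[OF assms(2)]
    ball_subset[OF assms(1)] by (meson leD order_refl subset_trans)

text \<open>Depth-first search: \<open>S\<close> is the set of finished vertices and \<open>xs\<close> the stack.\<close>

lemma dfs_path:
  assumes "finite V" "s \<le> card V" "symp E"
  shows "\<exists>S xs. S \<subseteq> V \<and> card S = s \<and> distinct xs \<and> set xs \<subseteq> V - S \<and> successively E xs \<and>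
    nbrs E V S \<subseteq> set xs"
  using assms(2)
proof (induction s)
  case 0
  show ?case by (intro exI[of _ "{}"] exI[of _ "[]"]) (auto simp: nbrs_def)
next
  case (Suc s)
  then obtain S xs0 where S: "S \<subseteq> V" "card S = s"
    and xs0: "distinct xs0 \<and> set xs0 \<subseteq> V - S \<and> successively E xs0 \<and> nbrs E V S \<subseteq> set xs0"
      (is "?Q xs0") by auto
  have fS: "finite S" using S(1) assms(1) finite_subset by blast
  have "\<forall>xs. ?Q xs \<longrightarrow> length xs < Suc (card V)"
    by (metis Diff_subset assms(1) card_mono distinct_card le_imp_less_Suc subset_trans)
  \<comment> \<open>Push as long as possible: the top of a longest admissible stack has no neighbour
    outside \<open>S\<close> and the stack, so moving it to \<open>S\<close> preserves the
    invariant.\<close>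
  then obtain xs where xs: "?Q xs" and max: "\<And>ys. ?Q ys \<Longrightarrow> length ys \<le> length xs"
    using ex_has_greatest_nat[of ?Q, OF xs0, of length "Suc (card V)"] by blast
  have "xs \<noteq> []"
  proof
    assume "xs = []"
    have "card S < card V" using Suc.prems S by simp
    then obtain v where "v \<in> V - S" by (metis Diff_iff S(1) less_irrefl subsetI subset_antisym)
    with xs \<open>xs = []\<close> have "?Q [v]" by auto
    from max[OF this] \<open>xs = []\<close> show False by simp
  qed
  have last: "v \<in> set xs" if "v \<in> V - S" "E (last xs) v" for v
  proof (rule ccontr)
    assume "v \<notin> set xs"
    with xs that have "?Q (xs @ [v])" by (auto simp: successively_append_iff)
    from max[OF this] show False by simp
  qed
  obtain ys x where ys: "xs = ys @ [x]" using \<open>xs \<noteq> []\<close> by (metis append_butlast_last_id)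
  have "nbrs E V (insert x S) \<subseteq> set ys"
    using last xs unfolding ys nbrs_def by auto
  moreover have "x \<in> V - S" "distinct ys" "set ys \<subseteq> V - insert x S" "successively E ys"
    using xs unfolding ys by (auto simp: successively_append_iff)
  moreover have "card (insert x S) = Suc s" using S(2) fS calculation(2) by simp
  ultimately show ?case using S(1)
    by (intro exI[of _ "insert x S"] exI[of _ ys]) simp
qed

section \<open>Expansion\<close>

text \<open>A set of more than half of the vertices expands because the complement of its closed
  neighbourhood does.\<close>

lemma expansion_large:
  fixes \<alpha> :: real
  assumes fin: "finite V" and sym: "symp E" and \<alpha>: "0 < \<alpha>" "\<alpha> \<le> 1"
    and exp: "\<And>U. U \<subseteq> V \<Longrightarrow> 2 * card U \<le> card V \<Longrightarrow> \<alpha> * card U \<le> card (nbrs E V U)"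
    and U: "U \<subseteq> V" "3 * card U \<le> 2 * card V"
  shows "\<alpha> / 4 * card U \<le> card (nbrs E V U)"
proof (cases "2 * card U \<le> card V")
  case True
  have "\<alpha> / 4 * card U \<le> \<alpha> * card U" using \<alpha> by (intro mult_right_mono) auto
  with exp[OF U(1) True] show ?thesis by linarith
next
  case False
  define N where "N = nbrs E V U"
  define R where "R = V - U - N"
  have NU: "N \<subseteq> V - U" by (auto simp: N_def nbrs_def)
  have fins: "finite U" "finite N" using U NU fin finite_subset by (blast, auto intro: finite_subset)
  have "card R = card V - card U - card N"
    unfolding R_def using NU U(1) fins by (simp add: card_Diff_subset)
  moreover have "card U + card N \<le> card V"
    using card_mono[OF fin, of "U \<union> N"] NU U(1) fins
    by (subst card_Un_disjoint[symmetric]) auto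
  ultimately have cR: "card R + card U + card N = card V" by simp
  have "nbrs E V R \<subseteq> N"
    using sym by (auto simp: nbrs_def N_def R_def symp_def)
  then have "card (nbrs E V R) \<le> card N" using fins by (simp add: card_mono)
  moreover have "\<alpha> * card R \<le> card (nbrs E V R)"
    using exp[of R] cR False by (auto simp: R_def)
  ultimately have "\<alpha> * card R \<le> card N" by linarith
  moreover have "real (card R) = real (card V) - card U - card N" using cR by linarith
  ultimately have 1: "\<alpha> * (real (card V) - card U - card N) \<le> card N" by simp
  have 2: "\<alpha> * card N \<le> card N" using \<alpha> by (simp add: mult_left_le_one_le)
  have 3: "\<alpha> * card U \<le> 2 * (\<alpha> * (real (card V) - card U))"
  proof -
    have "real (3 * card U) \<le> real (2 * card V)" using U(2) by (rule of_nat_mono)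
    then have "real (card U) \<le> 2 * (real (card V) - card U)" by simp
    then have "\<alpha> * real (card U) \<le> \<alpha> * (2 * (real (card V) - card U))" using \<alpha> by simp
    then show ?thesis by (simp only: ac_simps)
  qed
  \<comment> \<open>\<open>1\<close> and \<open>2\<close> give \<alpha> (|V| - |U|) \<le> 2 |N|, and
    \<open>3\<close> then gives \<alpha> |U| \<le> 4 |N|; hence the loss of a factor 4.\<close>
  show ?thesis using 1 2 3 unfolding N_def[symmetric] by (simp add: algebra_simps)
qed

text \<open>\<open>Z\<close> is a largest set of at most 2/3 of the vertices with expansion at most
  \<gamma>/2 inside \<open>V - P\<close>. At least \<gamma>/2 |Z| of its neighbours in
  \<open>V\<close> fall into \<open>P\<close>, so |Z| \<le> 2 |P|/\<gamma> \<le> |V|/6. A badly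
  expanding set in the rest could be added to \<open>Z\<close>, as 1/6 + 1/2 = 2/3.\<close>

lemma maximal_nonexpanding_set:
  fixes \<gamma> :: real
  assumes fin: "finite V" and \<gamma>: "0 < \<gamma>"
    and exp: "\<And>U. U \<subseteq> V \<Longrightarrow> 3 * card U \<le> 2 * card V \<Longrightarrow> \<gamma> * card U \<le> card (nbrs E V U)"
    and P: "P \<subseteq> V" "12 * card P \<le> \<gamma> * card V"
  obtains Z where "Z \<subseteq> V - P" "card (nbrs E (V - P) Z) \<le> \<gamma> / 2 * card Z"
    "6 * card Z \<le> card V"
    "\<And>A. A \<subseteq> V - P - Z \<Longrightarrow> 2 * card A \<le> card V \<Longrightarrow> \<gamma> / 2 * card A \<le> card (nbrs E (V - P - Z) A)"
proof -
  let ?Q = "\<lambda>Z. Z \<subseteq> V - P \<and> 3 * card Z \<le> 2 * card V \<and> card (nbrs E (V - P) Z) \<le> \<gamma> / 2 * card Z"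
  have "?Q {}" by (auto simp: nbrs_def)
  moreover have "\<forall>Z. ?Q Z \<longrightarrow> card Z < Suc (card V)"
    by (metis Diff_subset fin card_mono le_imp_less_Suc subset_trans)
  ultimately obtain Z where Z: "?Q Z" and max: "\<And>Y. ?Q Y \<Longrightarrow> card Y \<le> card Z"
    using ex_has_greatest_nat[of ?Q "{}" card "Suc (card V)"] by blast
  have fP: "finite P" and fZ: "finite Z" using P Z fin by (auto intro: finite_subset)
  have "nbrs E V Z \<subseteq> P \<union> nbrs E (V - P) Z" by (auto simp: nbrs_def)
  then have "card (nbrs E V Z) \<le> card (P \<union> nbrs E (V - P) Z)"
    using fP fin by (intro card_mono) (auto simp: finite_nbrs)
  also have "\<dots> \<le> card P + card (nbrs E (V - P) Z)" by (rule card_Un_le)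
  finally have "\<gamma> * card Z \<le> card P + \<gamma> / 2 * card Z"
    using exp[of Z] Z by (smt (verit) Diff_subset of_nat_add of_nat_mono subset_trans)
  then have "\<gamma> * (6 * card Z) \<le> \<gamma> * card V" using P(2) by simp
  then have 6: "6 * card Z \<le> card V" using \<gamma> by simp
  have "\<gamma> / 2 * card A \<le> card (nbrs E (V - P - Z) A)"
    if A: "A \<subseteq> V - P - Z" "2 * card A \<le> card V" for A
  proof (rule ccontr)
    assume neg: "\<not> ?thesis"
    have fA: "finite A" using A fin by (auto intro: finite_subset)
    have cA: "card (Z \<union> A) = card Z + card A" using A fA fZ by (intro card_Un_disjoint) auto
    have "nbrs E (V - P) (Z \<union> A) \<subseteq> nbrs E (V - P) Z \<union> nbrs E (V - P - Z) A"
      by (auto simp: nbrs_def)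
    then have "card (nbrs E (V - P) (Z \<union> A)) \<le> card (nbrs E (V - P) Z \<union> nbrs E (V - P - Z) A)"
      using fin by (intro card_mono) (auto simp: finite_nbrs)
    also have "\<dots> \<le> card (nbrs E (V - P) Z) + card (nbrs E (V - P - Z) A)" by (rule card_Un_le)
    finally have "card (nbrs E (V - P) (Z \<union> A)) \<le> \<gamma> / 2 * card (Z \<union> A)"
      using Z neg unfolding cA by (simp add: algebra_simps)
    then have "?Q (Z \<union> A)" using Z A 6 unfolding cA by auto
    from max[OF this] have "A = {}" using fA unfolding cA by simp
    with neg show False by simp
  qed
  with that Z 6 show thesis by blast
qed

text \<open>Matchings are sets of pairs on which both projections are injective. One of maximum size
  works, since an edge with \<open>x\<close> and \<open>y\<close> both uncovered could be
  inserted.\<close>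

lemma maximal_matching:
  assumes "finite P" "finite W"
  obtains M where "M \<subseteq> P \<times> W" "\<And>x y. (x, y) \<in> M \<Longrightarrow> E x y" "inj_on fst M" "inj_on snd M"
    "\<And>x y. x \<in> P \<Longrightarrow> y \<in> W \<Longrightarrow> E x y \<Longrightarrow> x \<in> fst ` M \<or> y \<in> snd ` M"
proof -
  let ?Q = "\<lambda>M. M \<subseteq> P \<times> W \<and> (\<forall>x y. (x, y) \<in> M \<longrightarrow> E x y) \<and> inj_on fst M \<and> inj_on snd M"
  have fin: "finite (P \<times> W)" using assms by simp
  have "?Q {}" by auto
  moreover have "\<forall>M. ?Q M \<longrightarrow> card M < Suc (card (P \<times> W))"
    using fin by (metis card_mono le_imp_less_Suc)
  ultimately obtain M where M: "?Q M" and max: "\<And>M'. ?Q M' \<Longrightarrow> card M' \<le> card M"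
    using ex_has_greatest_nat[of ?Q "{}" card "Suc (card (P \<times> W))"] by blast
  have "x \<in> fst ` M \<or> y \<in> snd ` M" if xy: "x \<in> P" "y \<in> W" "E x y" for x y
  proof (rule ccontr)
    assume n: "\<not> ?thesis"
    then have nM: "(x, y) \<notin> M" by force
    have "?Q (insert (x, y) M)" using M n xy by (auto simp: image_iff)
    moreover have "finite M" using M fin finite_subset by blast
    ultimately show False using max[of "insert (x, y) M"] nM by simp
  qed
  with that M show thesis by blast
qed

text \<open>Expansion of \<open>Z\<close> together with the unmatched part of \<open>P\<close> gives
  \<gamma> (|Z| + |P| - |M|) \<le> 2 |M| + \<gamma>/2 |Z|, hence \<gamma> |P| \<le> (2 + \<gamma>)
  |M|.\<close>

lemma large_matching:
  fixes \<gamma> :: real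
  assumes fin: "finite V" and \<gamma>: "0 < \<gamma>" "\<gamma> \<le> 1"
    and exp: "\<And>U. U \<subseteq> V \<Longrightarrow> 3 * card U \<le> 2 * card V \<Longrightarrow> \<gamma> * card U \<le> card (nbrs E V U)"
    and P: "P \<subseteq> V" "12 * card P \<le> \<gamma> * card V"
    and Z: "Z \<subseteq> V - P" "card (nbrs E (V - P) Z) \<le> \<gamma> / 2 * card Z" "6 * card Z \<le> card V"
  obtains M where "M \<subseteq> P \<times> (V - P - Z)" "\<And>x y. (x, y) \<in> M \<Longrightarrow> E x y" "inj_on fst M" "inj_on snd M"
    "\<gamma> * card P \<le> 3 * card M"
proof -
  have fP: "finite P" and fZ: "finite Z" using P Z fin by (auto intro: finite_subset)
  obtain M where M: "M \<subseteq> P \<times> (V - P - Z)" "\<And>x y. (x, y) \<in> M \<Longrightarrow> E x y" "inj_on fst M" "inj_on snd M"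
    and cover: "\<And>x y. x \<in> P \<Longrightarrow> y \<in> V - P - Z \<Longrightarrow> E x y \<Longrightarrow> x \<in> fst ` M \<or> y \<in> snd ` M"
    using maximal_matching[of P "V - P - Z" E] fP fin by (metis finite_Diff)
  define A where "A = fst ` M"
  define B where "B = snd ` M"
  have fM: "finite M" using M(1) fP fin by (meson finite_Diff finite_SigmaI finite_subset)
  have cA: "card A = card M" and cB: "card B = card M" using M(3,4) by (auto simp: A_def B_def card_image)
  have AP: "A \<subseteq> P" using M(1) by (auto simp: A_def)
  define U where "U = Z \<union> (P - A)"
  have cAP: "card A \<le> card P" using AP fP card_mono by blast
  have cU: "card U = card Z + (card P - card M)"
    unfolding U_def cA[symmetric] using AP fP fZ Z(1)
    by (subst card_Un_disjoint) (auto simp: card_Diff_subset finite_subset)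
  have "real (12 * card P) \<le> card V"
    using P(2) \<gamma> by (smt (verit) mult_left_le_one_le of_nat_0_le_iff)
  then have "12 * card P \<le> card V" by linarith
  then have "3 * card U \<le> 2 * card V" using cU Z(3) by linarith
  moreover have "U \<subseteq> V" using Z P by (auto simp: U_def)
  ultimately have "\<gamma> * card U \<le> card (nbrs E V U)" by (rule exp[rotated])
  also have "nbrs E V U \<subseteq> (A \<union> B) \<union> nbrs E (V - P) Z"
    using cover by (auto simp: nbrs_def U_def A_def B_def)
  then have "card (nbrs E V U) \<le> card ((A \<union> B) \<union> nbrs E (V - P) Z)"
    using fin fM by (intro card_mono) (auto simp: finite_nbrs A_def B_def)
  also have "\<dots> \<le> card A + card B + card (nbrs E (V - P) Z)"
    by (meson add_mono card_Un_le le_refl order_trans)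
  finally have "\<gamma> * card U \<le> 2 * card M + \<gamma> / 2 * card Z" using Z(2) cA cB by simp
  moreover have "real (card U) = card Z + (real (card P) - card M)"
    unfolding cU using cAP cA by (simp add: of_nat_diff)
  moreover have "\<gamma> * card M \<le> card M" "0 \<le> \<gamma> * card Z" using \<gamma> by (auto simp: mult_left_le_one_le)
  ultimately have "\<gamma> * card P \<le> 3 * card M" by (simp add: algebra_simps)
  with that M show thesis by blast
qed

section \<open>Counting levels\<close>

text \<open>\<open>J\<close> need not consist of consecutive indices: each index in \<open>J\<close>
  gains a factor \<open>q\<close>, and monotonicity bridges the gaps.\<close>

lemma geometric_chain_up:
  fixes f :: "nat \<Rightarrow> real"
  assumes "finite J" "J \<noteq> {}" "mono f" "1 \<le> q"
    and "\<And>i. i \<in> J \<Longrightarrow> q * f i \<le> f (Suc i)" "\<And>i. i \<in> J \<Longrightarrow> t \<le> f i"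
  shows "q ^ card J * t \<le> f (Suc (Max J))"
  using assms(1,2,5,6)
proof (induction J rule: finite_linorder_max_induct)
  case (insert b A)
  have b: "b \<notin> A" "Max (insert b A) = b" using insert.hyps
    by (auto intro: Max_eqI less_imp_le)
  have "q ^ card A * t \<le> f b"
  proof (cases "A = {}")
    case False
    then have "Suc (Max A) \<le> b" using insert.hyps by (simp add: Suc_le_eq)
    then have "f (Suc (Max A)) \<le> f b" by (rule monoD[OF \<open>mono f\<close>])
    with insert False show ?thesis by (smt (verit) insertI2)
  qed (use insert in auto)
  then have "q * (q ^ card A * t) \<le> q * f b" using \<open>1 \<le> q\<close> by (intro mult_left_mono) auto
  also have "\<dots> \<le> f (Suc b)" using insert by auto
  finally show ?case using b insert.hyps by (simp add: mult.assoc)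
qed auto

text \<open>The mirror image, read from the largest index downwards. That index contributes only the
  starting value \<open>t\<close>, as \<open>h\<close> has no lower bound beyond it; hence the
  exponent \<open>card J - 1\<close>.\<close>

lemma geometric_chain_down:
  fixes h :: "nat \<Rightarrow> real"
  assumes "finite J" "J \<noteq> {}" "antimono h" "1 \<le> q"
    and "\<And>i. i \<in> J \<Longrightarrow> q * h (Suc i) \<le> h i" "\<And>i. i \<in> J \<Longrightarrow> t \<le> h i"
  shows "q ^ (card J - 1) * t \<le> h (Min J)"
  using assms(1,2,5,6)
proof (induction J rule: finite_linorder_min_induct)
  case (insert b A)
  have b: "b \<notin> A" "Min (insert b A) = b" using insert.hyps
    by (auto intro: Min_eqI less_imp_le)
  show ?case
  proof (cases "A = {}")
    case False
    then have "Suc b \<le> Min A" using insert.hyps by (simp add: Suc_le_eq)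
    then have "h (Min A) \<le> h (Suc b)" by (rule antimonoD[OF \<open>antimono h\<close>])
    moreover have "q ^ (card A - 1) * t \<le> h (Min A)" using insert False by auto
    ultimately have "q * (q ^ (card A - 1) * t) \<le> q * h (Suc b)" using \<open>1 \<le> q\<close>
      by (intro mult_left_mono) auto
    also have "\<dots> \<le> h b" using insert by auto
    also have "q * (q ^ (card A - 1) * t) = q ^ card A * t"
      using False insert.hyps by (simp add: power_eq_if)
    finally show ?thesis using b insert.hyps by simp
  qed (use insert in auto)
qed auto

lemma card_le_ln_quotient:
  fixes q t n :: real
  assumes "1 < q" "0 < t" "q ^ m * t \<le> n"
  shows "real m \<le> ln (n / t) / ln q"
proof -
  have "q ^ m \<le> n / t" using assms by (simp add: pos_le_divide_eq)
  moreover have "0 < q ^ m" using assms by simp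
  ultimately have "ln (q ^ m) \<le> ln (n / t)" by (subst ln_le_cancel_iff) linarith+
  then show ?thesis using assms by (simp add: ln_realpow pos_le_divide_eq)
qed

text \<open>Going up, the sets of elements of level at most \<open>i\<close> grow by the factor
  \<open>q\<close> until they exceed n/2; from there on the sets of level at least \<open>i\<close>
  shrink by \<open>q\<close>. On the counted levels both sizes lie between \<open>t\<close> and
  \<open>n\<close>, which bounds the length of both chains.\<close>

lemma few_middle_levels:
  fixes d :: "'a \<Rightarrow> nat" and n q t :: real
  assumes fin: "finite W" and n: "card W \<le> n" and t: "0 < t" "t \<le> n" and q: "1 < q"
    and up: "\<And>i. 2 * card {v \<in> W. d v \<le> i} \<le> n \<Longrightarrow>
      q * card {v \<in> W. d v \<le> i} \<le> card {v \<in> W. d v \<le> Suc i}"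
    and down: "\<And>i. 2 * card {v \<in> W. Suc i \<le> d v} \<le> n \<Longrightarrow>
      q * card {v \<in> W. Suc i \<le> d v} \<le> card {v \<in> W. i \<le> d v}"
  shows "card {i \<in> d ` W. t < card {v \<in> W. d v \<le> i} \<and> t < card {v \<in> W. i \<le> d v}}
    \<le> 2 * (ln (n / t) / ln q) + 1"
proof -
  define b where "b = (\<lambda>i. real (card {v \<in> W. d v \<le> i}))"
  define h where "h = (\<lambda>i. real (card {v \<in> W. i \<le> d v}))"
  define J where "J = {i \<in> d ` W. t < b i \<and> t < h i}"
  define J1 where "J1 = {i \<in> J. 2 * b i \<le> n}"
  define J2 where "J2 = J - J1"
  have fJ: "finite J" "finite J1" using fin by (simp_all add: J_def J1_def)
  have bn: "b i \<le> n" "h i \<le> n" for i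
    using n card_mono[OF fin, of "{v \<in> W. d v \<le> i}"] card_mono[OF fin, of "{v \<in> W. i \<le> d v}"]
    by (auto simp: b_def h_def)
  have mono: "mono b" "antimono h"
    using fin by (auto simp: mono_def antimono_def b_def h_def intro!: card_mono)
  have bh: "b i + h (Suc i) \<le> n" for i
  proof -
    have "card {v \<in> W. d v \<le> i} + card {v \<in> W. Suc i \<le> d v} = card W"
      using fin by (subst card_Un_disjoint[symmetric]) (auto intro!: arg_cong[of _ _ card])
    with n show ?thesis by (simp add: b_def h_def flip: of_nat_add)
  qed
  have ln0: "0 \<le> ln (n / t) / ln q" using t q by simp
  have 1: "real (card J1) \<le> ln (n / t) / ln q"
  proof (cases "J1 = {}")
    case False
    have "q ^ card J1 * t \<le> b (Suc (Max J1))"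
    proof (rule geometric_chain_up)
      fix i assume i: "i \<in> J1"
      then show "q * b i \<le> b (Suc i)" unfolding J1_def b_def by (intro up) simp
      show "t \<le> b i" using i by (simp add: J1_def J_def)
    qed (use False fJ mono q in auto)
    also have "\<dots> \<le> n" by (rule bn)
    finally show ?thesis by (rule card_le_ln_quotient[OF q t(1)])
  qed (use ln0 in simp)
  have "real (card J2 - 1) \<le> ln (n / t) / ln q"
  proof (cases "J2 = {}")
    case False
    have "q ^ (card J2 - 1) * t \<le> h (Min J2)"
    proof (rule geometric_chain_down)
      fix i assume i: "i \<in> J2"
      then have "n < 2 * b i" by (auto simp: J2_def J1_def)
      with bh[of i] have "2 * h (Suc i) \<le> n" by linarith
      then show "q * h (Suc i) \<le> h i" unfolding h_def by (intro down) simp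
    qed (use False fJ mono q in \<open>auto simp: J2_def J_def\<close>)
    also have "\<dots> \<le> n" by (rule bn)
    finally show ?thesis by (rule card_le_ln_quotient[OF q t(1)])
  qed (use ln0 in simp)
  moreover have "card J = card J1 + card J2"
    unfolding J2_def using fJ by (subst card_Diff_subset) (auto simp: J1_def card_mono)
  ultimately have "real (card J) \<le> 2 * (ln (n / t) / ln q) + 1" using 1 by linarith
  then show ?thesis by (simp add: J_def b_def h_def)
qed

text \<open>All these \<open>y\<close> lie in the lower set of one of them with maximal
  \<open>d\<close>, and that set has at most \<open>t\<close> elements.\<close>

lemma card_lower_levels:
  fixes d :: "'a \<Rightarrow> nat" and t :: real
  assumes fin: "finite W" and t: "0 \<le> t"
  shows "card {y \<in> W. card {v \<in> W. d v \<le> d y} \<le> t} \<le> t"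
proof (cases "{y \<in> W. card {v \<in> W. d v \<le> d y} \<le> t} = {}")
  case False
  let ?B = "{y \<in> W. card {v \<in> W. d v \<le> d y} \<le> t}"
  have "Max (d ` ?B) \<in> d ` ?B" using False fin by (intro Max_in) auto
  then obtain z where z: "z \<in> ?B" "d z = Max (d ` ?B)" by force
  have "?B \<subseteq> {v \<in> W. d v \<le> d z}" using z fin by auto
  then have "card ?B \<le> card {v \<in> W. d v \<le> d z}" using fin by (intro card_mono) auto
  with z show ?thesis by simp
qed (use t in \<open>metis card.empty of_nat_0\<close>)

lemma card_upper_levels:
  fixes d :: "'a \<Rightarrow> nat" and t :: real
  assumes fin: "finite W" and t: "0 \<le> t"
  shows "card {y \<in> W. card {v \<in> W. d y \<le> d v} \<le> t} \<le> t"
proof (cases "{y \<in> W. card {v \<in> W. d y \<le> d v} \<le> t} = {}")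
  case False
  let ?B = "{y \<in> W. card {v \<in> W. d y \<le> d v} \<le> t}"
  have "Min (d ` ?B) \<in> d ` ?B" using False fin by (intro Min_in) auto
  then obtain z where z: "z \<in> ?B" "d z = Min (d ` ?B)" by force
  have "?B \<subseteq> {v \<in> W. d z \<le> d v}" using z fin by auto
  then have "card ?B \<le> card {v \<in> W. d z \<le> d v}" using fin by (intro card_mono) auto
  with z show ?thesis by simp
qed (use t in \<open>metis card.empty of_nat_0\<close>)

text \<open>The sum together with \<open>d y\<close> determines \<open>f y\<close> and thus
  \<open>y\<close>. With positions along a path as \<open>f\<close> and depths as \<open>d\<close>,
  the sums are cycle lengths up to a constant, so few depths force many lengths.\<close>

lemma card_le_sums_times_levels:
  fixes f d :: "'a \<Rightarrow> nat"
  assumes "finite Y" "inj_on f Y"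
  shows "card Y \<le> card ((\<lambda>y. f y + d y) ` Y) * card (d ` Y)"
proof -
  have "inj_on (\<lambda>y. (f y + d y, d y)) Y" using assms(2) by (auto simp: inj_on_def)
  then have "card Y \<le> card ((\<lambda>y. f y + d y) ` Y \<times> d ` Y)"
    using assms(1) by (intro card_inj_on_le) auto
  then show ?thesis by (simp add: card_cartesian_product)
qed

section \<open>Cycles from a path and a connected expanding set\<close>

text \<open>The cycle runs along \<open>xs\<close> from index \<open>a\<close> to \<open>b\<close>
  and returns through \<open>vs\<close> backwards. Since \<open>a < b\<close>, it has at least two
  vertices on \<open>xs\<close> and one on \<open>vs\<close>, hence length at least 3.\<close>

lemma circuit_of_path_and_detour:
  assumes "symp E" "distinct xs" "successively E xs" "a < b" "b < length xs" "set xs \<subseteq> V"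
    and "vs \<noteq> []" "distinct vs" "successively E vs" "set vs \<subseteq> V - set xs"
    and "E (xs ! a) (hd vs)" "E (xs ! b) (last vs)"
  shows "b - a + 1 + length vs \<in> circuit_lengths E V"
proof -
  define seg where "seg = drop a (take (Suc b) xs)"
  have len: "length seg = b - a + 1" using assms(4,5) by (simp add: seg_def)
  have ne: "seg \<noteq> []" using len by auto
  have hd: "hd seg = xs ! a" using assms(4,5) by (simp add: seg_def hd_drop_conv_nth)
  have last: "last seg = xs ! b" using assms(4,5)
    by (simp add: seg_def last_conv_nth)
  have sub: "set seg \<subseteq> set xs" unfolding seg_def by (meson order_trans set_drop_subset set_take_subset)
  have "xs = take a (take (Suc b) xs) @ seg @ drop (Suc b) xs"
    unfolding seg_def by (metis append.assoc append_take_drop_id)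
  then have "successively E seg" using assms(3) by (metis successively_append_iff)
  moreover have "distinct seg" using assms(2) by (simp add: seg_def)
  moreover have E: "E x y = E y x" for x y using assms(1) by (auto simp: symp_def)
  ultimately have "length (seg @ rev vs) \<in> circuit_lengths E V"
    using assms(6-12) ne sub hd last len assms(4)
    by (intro circuitI) (auto simp: successively_append_iff hd_rev last_rev neq_Nil_conv[of vs])
  then show ?thesis by (simp add: len)
qed

text \<open>No edge joins the set \<open>R\<close> reached from \<open>r\<close> to
  \<open>W - R\<close>. One of the two has at most n/2 elements and, having no neighbours in
  \<open>W\<close>, must be empty; it is not \<open>R\<close>, which contains
  \<open>r\<close>.\<close>

lemma expanding_reachable:
  fixes \<beta> :: real
  assumes fin: "finite W" and sym: "symp E" and n: "card W \<le> n" and \<beta>: "0 < \<beta>" and r: "r \<in> W"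
    and exp: "\<And>A. A \<subseteq> W \<Longrightarrow> 2 * card A \<le> n \<Longrightarrow> \<beta> * card A \<le> card (nbrs E W A)"
  shows "W = (\<Union>i. ball E W r i)"
proof -
  define R where "R = (\<Union>i. ball E W r i)"
  have RW: "R \<subseteq> W" using ball_subset[OF r] by (auto simp: R_def)
  have rR: "r \<in> R" using root_in_ball[of r E W 0] unfolding R_def by blast
  have closed: "v \<in> R" if "u \<in> R" "E u v" "v \<in> W" for u v
    using that ball_closed[of u E W r _ v] unfolding R_def by blast
  have empty: "A = {}" if "A \<subseteq> W" "2 * card A \<le> n" "nbrs E W A = {}" for A
  proof -
    have "\<beta> * card A \<le> 0" using exp[OF that(1,2)] that(3) by simp
    then have "card A = 0" using \<beta> by (simp add: mult_le_0_iff)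
    moreover have "finite A" using that(1) fin by (rule finite_subset)
    ultimately show ?thesis by simp
  qed
  have "nbrs E W R = {}" using closed by (auto simp: nbrs_def)
  then have "\<not> 2 * card R \<le> n" using empty[of R] RW rR by auto
  then have "2 * card (W - R) \<le> n"
    using n RW fin by (simp add: card_Diff_subset finite_subset)
  moreover have "nbrs E W (W - R) = {}"
    using closed sym by (auto simp: nbrs_def symp_def)
  ultimately have "W - R = {}" using empty[of "W - R"] by auto
  then show ?thesis using RW unfolding R_def by auto
qed

lemma many_circuit_lengths:
  fixes \<beta> :: real
  assumes fin: "finite V" and sym: "symp E" and W: "W \<subseteq> V" and \<beta>: "0 < \<beta>"
    and exp: "\<And>A. A \<subseteq> W \<Longrightarrow> 2 * card A \<le> card V \<Longrightarrow> \<beta> * card A \<le> card (nbrs E W A)"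
    and xs: "distinct xs" "successively E xs" "set xs \<subseteq> V - W"
    and M: "M \<subseteq> set xs \<times> W" "\<And>x y. (x, y) \<in> M \<Longrightarrow> E x y" "inj_on fst M" "inj_on snd M"
    and k: "4 \<le> card M"
  shows "card M / 2 \<le> card (circuit_lengths E V) *
    (2 * (ln (4 * real (card V) / card M) / ln (1 + \<beta>)) + 1)"
proof -
  define Y where "Y = snd ` M"
  have finW: "finite W" using W fin finite_subset by blast
  have YW: "Y \<subseteq> W" using M(1) by (auto simp: Y_def)
  have finY: "finite Y" using YW finW finite_subset by blast
  have cY: "card Y = card M" using M(4) by (simp add: Y_def card_image)
  have "\<exists>i. i < length xs \<and> (xs ! i, y) \<in> M" if "y \<in> Y" for y
  proof -
    obtain x where "(x, y) \<in> M" using \<open>y \<in> Y\<close> by (auto simp: Y_def)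
    moreover from this have "x \<in> set xs" using M(1) by auto
    ultimately show ?thesis by (metis in_set_conv_nth)
  qed
  then obtain pos where pos: "\<And>y. y \<in> Y \<Longrightarrow> pos y < length xs" "\<And>y. y \<in> Y \<Longrightarrow> (xs ! pos y, y) \<in> M"
    by metis
  have inj: "inj_on pos Y"
    using pos(2) M(3) by (auto simp: inj_on_def) (metis fst_conv snd_conv)
  have "Y \<noteq> {}" using cY k by auto
  then have "Min (pos ` Y) \<in> pos ` Y" using finY by simp
  then obtain y0 where y0: "y0 \<in> Y" "pos y0 = Min (pos ` Y)" by force
  have min: "pos y0 \<le> pos y" if "y \<in> Y" for y using that y0 finY by simp
  have y0W: "y0 \<in> W" using y0 YW by auto
  have cWV: "card W \<le> card V" using W fin card_mono by blast
  have reach: "W = (\<Union>i. ball E W y0 i)"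
    by (rule expanding_reachable[OF finW sym cWV \<beta> y0W exp])
  define d where "d = depth E W y0"
  have ball: "ball E W y0 i = {v \<in> W. d v \<le> i}" for i
    using in_ball_iff_depth[of _ E W y0 i] ball_subset[OF y0W, of E i] reach
    unfolding d_def by blast
  have d0: "{v \<in> W. d v \<le> d y0} = {y0}"
  proof -
    have "d y0 \<le> 0" using ball[of 0] by auto
    then show ?thesis using ball[of 0] by simp
  qed
  have step: "d v \<le> Suc (d u)" if "u \<in> W" "v \<in> W" "E u v" for u v
  proof -
    have "v \<in> ball E W y0 (Suc (d u))" by (rule ball_closed[of u]) (use that ball in auto)
    then show ?thesis unfolding ball by simp
  qed
  have up: "(1 + \<beta>) * card {v \<in> W. d v \<le> i} \<le> card {v \<in> W. d v \<le> Suc i}"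
    if "2 * card {v \<in> W. d v \<le> i} \<le> real (card V)" for i
  proof -
    have "{v \<in> W. d v \<le> Suc i} = {v \<in> W. d v \<le> i} \<union> nbrs E W {v \<in> W. d v \<le> i}"
      using ball[of "Suc i"] ball[of i] by simp
    moreover have "card ({v \<in> W. d v \<le> i} \<union> nbrs E W {v \<in> W. d v \<le> i}) =
      card {v \<in> W. d v \<le> i} + card (nbrs E W {v \<in> W. d v \<le> i})"
      using finW by (intro card_Un_disjoint) (auto simp: nbrs_def)
    ultimately show ?thesis using exp[of "{v \<in> W. d v \<le> i}"] that
      by (simp add: algebra_simps)
  qed
  \<comment> \<open>An edge changes the depth by at most 1, so neighbours of vertices of depth at
    least i + 1 have depth at least \<open>i\<close>.\<close>
  have down: "(1 + \<beta>) * card {v \<in> W. Suc i \<le> d v} \<le> card {v \<in> W. i \<le> d v}"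
    if "2 * card {v \<in> W. Suc i \<le> d v} \<le> real (card V)" for i
  proof -
    let ?Q = "{v \<in> W. Suc i \<le> d v}"
    have "?Q \<union> nbrs E W ?Q \<subseteq> {v \<in> W. i \<le> d v}"
    proof
      fix v assume v: "v \<in> ?Q \<union> nbrs E W ?Q"
      show "v \<in> {v \<in> W. i \<le> d v}"
      proof (cases "v \<in> ?Q")
        case False
        with v obtain u where "u \<in> ?Q" "E u v" "v \<in> W" by (auto simp: nbrs_def)
        with step[of v u] sym show ?thesis by (auto simp: symp_def)
      qed auto
    qed
    then have "card (?Q \<union> nbrs E W ?Q) \<le> card {v \<in> W. i \<le> d v}"
      using finW by (intro card_mono) auto
    moreover have "card (?Q \<union> nbrs E W ?Q) = card ?Q + card (nbrs E W ?Q)"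
      using finW by (intro card_Un_disjoint) (auto simp: nbrs_def)
    ultimately show ?thesis using exp[of ?Q] that by (simp add: algebra_simps)
  qed
  \<comment> \<open>At most \<open>t\<close> matched vertices lie too low and at most
    \<open>t\<close> too high for the middle levels \<open>I\<close>, so the threshold |M|/4 keeps
    at least half of the matching.\<close>
  define t where "t = card M / (4 :: real)"
  have t: "1 \<le> t" "t \<le> card V"
  proof -
    have "card M \<le> card V" using cY YW W fin card_mono[of V Y] by auto
    then show "1 \<le> t" "t \<le> card V" using k by (auto simp: t_def)
  qed
  define I where "I = {i \<in> d ` W. t < card {v \<in> W. d v \<le> i} \<and> t < card {v \<in> W. i \<le> d v}}"
  have "real (card I) \<le> 2 * (ln (card V / t) / ln (1 + \<beta>)) + 1"
    unfolding I_def using t \<beta> cWV up down by (intro few_middle_levels finW) auto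
  then have cI: "real (card I) \<le> 2 * (ln (4 * real (card V) / card M) / ln (1 + \<beta>)) + 1"
    by (simp add: t_def mult.commute)
  have fI: "finite I" using finW by (simp add: I_def)
  define Y' where "Y' = {y \<in> Y. d y \<in> I}"
  define Lo where "Lo = {y \<in> W. card {v \<in> W. d v \<le> d y} \<le> t}"
  define Hi where "Hi = {y \<in> W. card {v \<in> W. d y \<le> d v} \<le> t}"
  have lohi: "card Lo \<le> t" "card Hi \<le> t"
    unfolding Lo_def Hi_def using card_lower_levels[OF finW, of t d] card_upper_levels[OF finW, of t d] t
    by auto
  have "Y \<subseteq> Y' \<union> (Lo \<union> Hi)" using YW by (auto simp: Y'_def I_def Lo_def Hi_def)
  then have "card Y \<le> card (Y' \<union> (Lo \<union> Hi))"
    using finY finW by (intro card_mono) (auto simp: Y'_def Lo_def Hi_def)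
  also have "\<dots> \<le> card Y' + (card Lo + card Hi)"
    by (meson add_left_mono card_Un_le order_trans)
  finally have "real (card M) \<le> card Y' + 2 * t" using lohi cY by linarith
  then have cY': "card M / 2 \<le> real (card Y')" by (simp add: t_def)
  have fY': "finite Y'" using finY by (simp add: Y'_def)
  \<comment> \<open>\<open>y0\<close> itself closes no cycle. It is alone at its depth 0, and 1
    \<le> \<open>t\<close>, which rests on 4 \<le> |M|, keeps that level out of
    \<open>I\<close>.\<close>
  have "y0 \<notin> Y'" using t d0 by (auto simp: Y'_def I_def)
  have len: "(pos y - pos y0) + d y + 2 \<in> circuit_lengths E V" if "y \<in> Y'" for y
  proof -
    have yY: "y \<in> Y" and "y \<noteq> y0" using that \<open>y0 \<notin> Y'\<close> by (auto simp: Y'_def)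
    then have lt: "pos y0 < pos y" using min[of y] inj y0(1) by (metis inj_onD le_neq_implies_less)
    have "y \<in> (\<Union>i. ball E W y0 i)" using yY YW reach by auto
    from depth_path[OF y0W this] obtain vs where vs: "vs \<noteq> []" "hd vs = y0" "last vs = y"
      "distinct vs" "set vs \<subseteq> W" "length vs = Suc (d y)" "successively E vs" by (auto simp: d_def)
    have "pos y - pos y0 + 1 + length vs \<in> circuit_lengths E V"
      using vs xs W lt pos[OF yY] pos[OF y0(1)] M(2)
      by (intro circuit_of_path_and_detour[OF sym xs(1,2) lt]) auto
    then show ?thesis using vs(6) by simp
  qed
  \<comment> \<open>Truncated subtraction loses nothing here because \<open>pos y0\<close> is
    minimal.\<close>
  have "inj_on (\<lambda>y. pos y - pos y0) Y'"
    using inj min unfolding Y'_def inj_on_def by (metis (no_types, lifting) eq_diff_iff mem_Collect_eq)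
  from card_le_sums_times_levels[OF fY' this, of d]
  have "card Y' \<le> card ((\<lambda>y. pos y - pos y0 + d y) ` Y') * card (d ` Y')" .
  also have "card ((\<lambda>y. pos y - pos y0 + d y) ` Y') = card ((\<lambda>m. m + 2) ` (\<lambda>y. pos y - pos y0 + d y) ` Y')"
    by (intro card_image[symmetric]) (simp add: inj_on_def)
  also have "\<dots> \<le> card (circuit_lengths E V)"
    using len finite_circuit_lengths[OF fin] by (intro card_mono) auto
  also have "card (d ` Y') \<le> card I" using fI by (intro card_mono) (auto simp: Y'_def)
  finally have "card Y' \<le> card (circuit_lengths E V) * card I" by simp
  then have "real (card Y') \<le> card (circuit_lengths E V) * real (card I)"
    by (metis of_nat_mono of_nat_mult)
  also have "\<dots> \<le> card (circuit_lengths E V) * (2 * (ln (4 * real (card V) / card M) / ln (1 + \<beta>)) + 1)"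
    using cI by (intro mult_left_mono) auto
  finally show ?thesis using cY' by linarith
qed

section \<open>Existence of a single cycle\<close>

text \<open>Let \<open>U\<close> be a largest set with at most one outside neighbour \<open>v\<close>; it is small. If \<open>v\<close> lay on no
  cycle, then a component beyond \<open>v\<close> could be added to \<open>U\<close>.\<close>

lemma circuit_exists:
  fixes \<alpha> :: real
  assumes fin: "finite V" and sym: "symp E" and \<alpha>: "0 < \<alpha>" "\<alpha> \<le> 1"
    and exp: "\<And>U. U \<subseteq> V \<Longrightarrow> 2 * card U \<le> card V \<Longrightarrow> \<alpha> * card U \<le> card (nbrs E V U)"
    and n: "4 / \<alpha> \<le> card V"
  shows "circuit_lengths E V \<noteq> {}"
proof -
  let ?Q = "\<lambda>U. U \<subseteq> V \<and> 2 * card U \<le> card V \<and> card (nbrs E V U) \<le> 1"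
  have "?Q {}" by (auto simp: nbrs_def)
  moreover have "\<forall>U. ?Q U \<longrightarrow> card U < Suc (card V)" by auto
  ultimately obtain U where U: "?Q U" and max: "\<And>U'. ?Q U' \<Longrightarrow> card U' \<le> card U"
    using ex_has_greatest_nat[of ?Q "{}" card "Suc (card V)"] by blast
  have n4: "4 \<le> \<alpha> * card V" using n \<alpha> by (simp add: pos_divide_le_eq mult.commute)
  \<comment> \<open>Such a set has at most 1/\<alpha> \<le> |V|/4 elements, so the union of two of
    them still has at most half of the vertices.\<close>
  have small: "4 * card A \<le> card V" if "?Q A" for A
  proof -
    have "\<alpha> * card A \<le> 1" using exp[of A] that by (meson of_nat_le_1_iff order_trans)
    then have "\<alpha> * (4 * card A) \<le> \<alpha> * card V" using n4 by simp
    then show ?thesis using \<alpha> by simp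
  qed
  have "\<alpha> * card V \<le> card V" using \<alpha> by (simp add: mult_left_le_one_le)
  with n4 have V4: "4 \<le> card V" by linarith
  have fU: "finite U" using U fin finite_subset by blast
  \<comment> \<open>If \<open>U\<close> has no outside neighbour at all, any vertex outside it can
    serve as \<open>v\<close>.\<close>
  obtain v where v: "v \<in> V - U" "nbrs E V U \<subseteq> {v}"
  proof (cases "nbrs E V U = {}")
    case True
    have "card U < card V" using small[OF U] V4 by linarith
    then obtain v where "v \<in> V - U" by (metis Diff_iff U less_irrefl subsetI subset_antisym)
    with True that show ?thesis by auto
  next
    case False
    have "finite (nbrs E V U)" using fin by (rule finite_nbrs)
    then have "card (nbrs E V U) \<noteq> 0" using False by simp
    then have "card (nbrs E V U) = 1" using U by linarith
    then obtain v where "nbrs E V U = {v}" by (rule card_1_singletonE)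
    with that[of v] show ?thesis by (auto simp: nbrs_def)
  qed
  define S where "S = V - U - {v}"
  have SV: "S \<subseteq> V" by (auto simp: S_def)
  have E: "E x y = E y x" for x y using sym by (auto simp: symp_def)
  have US: "\<not> E u s" if "u \<in> U" "s \<in> S" for u s
    using v(2) that by (auto simp: S_def nbrs_def)
  \<comment> \<open>Otherwise \<open>insert v U\<close> would be a larger candidate. Hence
    \<open>v\<close> has two neighbours in \<open>S\<close>.\<close>
  have "\<not> card (nbrs E V (insert v U)) \<le> 1"
  proof
    assume "card (nbrs E V (insert v U)) \<le> 1"
    moreover have "card (insert v U) = Suc (card U)" using v fU by simp
    ultimately have "?Q (insert v U)" using U v V4 small[OF U] by auto
    from max[OF this] show False using v fU by simp
  qed
  moreover have "nbrs E V (insert v U) \<subseteq> {w \<in> S. E v w}"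
    using US by (auto simp: nbrs_def S_def)
  then have "card (nbrs E V (insert v U)) \<le> card {w \<in> S. E v w}"
    using fin SV by (intro card_mono) (auto intro: finite_subset)
  ultimately have "2 \<le> card {w \<in> S. E v w}" by linarith
  then obtain w1 w2 where w: "w1 \<in> S" "E v w1" "w2 \<in> S" "E v w2" "w1 \<noteq> w2"
    by (auto simp: card_le_Suc_iff numeral_2_eq_2)
  \<comment> \<open>The component of \<open>w1\<close> in the graph induced on \<open>S\<close>. If
    it contains \<open>w2\<close>, a path between them closes up through \<open>v\<close>; otherwise
    the smaller of \<open>R\<close> and \<open>S - R\<close> can be added to
    \<open>U\<close>.\<close>
  define R where "R = (\<Union>i. ball E S w1 i)"
  have RS: "R \<subseteq> S" using ball_subset[OF w(1)] by (auto simp: R_def)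
  have w1R: "w1 \<in> R" using root_in_ball[of w1 E S 0] unfolding R_def by blast
  have closed: "z \<in> R" if "u \<in> R" "E u z" "z \<in> S" for u z
    using that ball_closed[of u E S w1 _ z] unfolding R_def by blast
  show ?thesis
  proof (cases "w2 \<in> R")
    case True
    from depth_path[OF w(1), of w2 E] True obtain vs where vs: "vs \<noteq> []" "hd vs = w1" "last vs = w2"
      "distinct vs" "set vs \<subseteq> S" "successively E vs" by (auto simp: R_def)
    have "2 \<le> length vs" using vs w(5) by (cases vs rule: remdups_adj.cases) auto
    moreover have "v \<notin> S" "v \<in> V" using v by (auto simp: S_def)
    ultimately have "length (v # vs) \<in> circuit_lengths E V"
      using vs w SV E by (intro circuitI) (auto simp: successively_Cons)
    then show ?thesis by auto
  next
    case False
    have "\<exists>D. D \<subseteq> S \<and> D \<noteq> {} \<and> 2 * card D \<le> card V \<and> nbrs E V D \<subseteq> {v}"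
    proof (cases "2 * card R \<le> card V")
      case True
      have "nbrs E V R \<subseteq> {v}" using closed US RS E by (auto simp: nbrs_def S_def) blast+
      then show ?thesis using True RS w1R by blast
    next
      case False
      have "nbrs E V (S - R) \<subseteq> {v}" using closed US RS E by (auto simp: nbrs_def S_def)
      moreover have "card (S - R) + card R \<le> card V"
      proof -
        have "finite S" "finite R" using SV RS fin finite_subset by metis+
        then have "card (S - R) + card R = card S" using RS by (simp add: card_Diff_subset card_mono)
        then show ?thesis using card_mono[OF fin SV] by simp
      qed
      ultimately show ?thesis using False \<open>w2 \<notin> R\<close> w(3) by (intro exI[of _ "S - R"]) auto
    qed
    then obtain D where D: "D \<subseteq> S" "D \<noteq> {}" "2 * card D \<le> card V" "nbrs E V D \<subseteq> {v}" by blast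
    have le1: "card A \<le> 1" if "A \<subseteq> {v}" for A using card_mono[OF _ that] by simp
    have QD: "?Q D" using D SV le1 by auto
    have fD: "finite D" using D SV fin by (meson finite_subset)
    have c: "card (U \<union> D) = card U + card D" using fU fD D(1) by (intro card_Un_disjoint) (auto simp: S_def)
    have "nbrs E V (U \<union> D) \<subseteq> {v}" using D(4) v(2) by (auto simp: nbrs_def)
    then have "?Q (U \<union> D)" using le1 U QD small[OF U] small[OF QD] c by auto
    from max[OF this] c have "card D = 0" by simp
    then show ?thesis using fD D(2) by simp
  qed
qed

section \<open>Cycles of symmetric digraphs\<close>

lemma (in wf_digraph) awalk_of_successively:
  assumes "vs \<noteq> []" "set vs \<subseteq> verts G" "successively (\<lambda>u v. u \<rightarrow> v) vs"
  shows "\<exists>p. awalk (hd vs) p (last vs) \<and> awalk_verts (hd vs) p = vs"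
  using assms
proof (induction vs rule: induct_list012)
  case (2 x)
  then show ?case by (intro exI[of _ "[]"]) (auto simp: awalk_Nil_iff)
next
  case (3 x y zs)
  then obtain p where p: "awalk y p (last (y # zs))" "awalk_verts y p = y # zs" by auto
  from 3 obtain e where "e \<in> arcs G" "tail G e = x" "head G e = y"
    by (auto simp: arcs_ends_def arc_to_ends_def)
  with p show ?case by (intro exI[of _ "e # p"]) (auto simp: awalk_Cons_iff)
qed auto

text \<open>Closing the vertex list by its head yields a walk with as many arcs as \<open>vs\<close>
  has vertices. The definition of \<open>cycle\<close> asks for distinctness after dropping the
  first vertex, which the walk visits again at its end.\<close>

lemma (in wf_digraph) circuit_lengths_subset_cycle_lengths:
  "circuit_lengths (\<lambda>u v. u \<rightarrow> v) (verts G) \<subseteq> cycle_lengths G"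
proof
  fix l assume "l \<in> circuit_lengths (\<lambda>u v. u \<rightarrow> v) (verts G)"
  then obtain vs where vs: "l = length vs" "distinct vs" "3 \<le> length vs" "set vs \<subseteq> verts G"
    "successively (\<lambda>u v. u \<rightarrow> v) vs" "last vs \<rightarrow> hd vs" by (auto simp: circuit_lengths_def)
  have ne: "vs \<noteq> []" using vs(3) by auto
  then have "hd vs \<in> verts G" using vs(4) by auto
  then obtain p where p: "awalk (hd vs) p (hd vs)" "awalk_verts (hd vs) p = vs @ [hd vs]"
    using awalk_of_successively[of "vs @ [hd vs]"] vs ne by (auto simp: successively_append_iff)
  have len: "length p = length vs" using arg_cong[OF p(2), of length] by (simp add: length_awalk_verts)
  have "distinct (tl vs @ [hd vs])" using vs(2) ne by (cases vs) auto
  then have "distinct (tl (awalk_verts (hd vs) p))" using p(2) ne by simp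
  then have "cycle p" using p(1) len ne unfolding cycle_def by auto
  then show "l \<in> cycle_lengths G" using vs(1,3) len unfolding cycle_lengths_def
    by (intro CollectI exI[of _ p]) simp
qed

lemma (in fin_digraph) finite_cycle_lengths: "finite (cycle_lengths G)"
proof (rule finite_subset)
  show "cycle_lengths G \<subseteq> {..card (verts G)}"
  proof
    fix l assume "l \<in> cycle_lengths G"
    then obtain p u where p: "l = length p" "awalk u p u" "distinct (tl (awalk_verts u p))"
      by (auto simp: cycle_lengths_def cycle_def)
    have "set (awalk_verts u p) \<subseteq> verts G" using p(2) by (rule awalkE)
    then have "set (tl (awalk_verts u p)) \<subseteq> verts G" by (cases "awalk_verts u p") auto
    then have "length (tl (awalk_verts u p)) \<le> card (verts G)"
      using p(3) card_mono[OF finite_verts] by (metis distinct_card)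
    then show "l \<in> {..card (verts G)}" using p(1) by (simp add: length_awalk_verts)
  qed
qed simp

section \<open>Constants and assembly\<close>

text \<open>Since 4 * 1152 \<le> 2^13, the numerator is at most 13 ln 2 + 2 ln(1/\<alpha>) \<le> 15
  m, where \<open>m\<close> is the maximum. The denominator is at least \<alpha>/16 by ln(1 + x)
  \<ge> x - x^2 \<ge> x/2 for x = \<alpha>/8. The doubled quotient is thus at most 480 m/\<alpha>,
  and 1 \<le> m/\<alpha>.\<close>

lemma level_count_bound:
  fixes \<alpha> k n :: real
  assumes \<alpha>: "0 < \<alpha>" "\<alpha> \<le> 1" and n: "0 < n" and k: "\<alpha>\<^sup>2 * n / 1152 \<le> k"
  shows "2 * (ln (4 * n / k) / ln (1 + \<alpha> / 8)) + 1 \<le> 481 * max 1 (log 2 (1 / \<alpha>)) / \<alpha>"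
proof -
  define m where "m = max 1 (log 2 (1 / \<alpha>))"
  have m: "1 \<le> m" "log 2 (1 / \<alpha>) \<le> m" by (auto simp: m_def)
  have k0: "0 < k" using k \<alpha> n by (smt (verit) divide_pos_pos mult_pos_pos zero_less_power)
  have ln2: "0 < ln (2 :: real)" "ln (2 :: real) \<le> 1" using ln_2_less_1 by auto
  have "\<alpha>\<^sup>2 * n \<le> 1152 * k" using k by simp
  then have "4 * n / k \<le> 2 ^ 13 * (1 / \<alpha>)\<^sup>2"
    using k0 \<alpha> n by (simp add: divide_simps mult.commute)
  then have "ln (4 * n / k) \<le> ln (2 ^ 13 * (1 / \<alpha>)\<^sup>2)"
    using k0 \<alpha> n by (subst ln_le_cancel_iff) auto
  also have "\<dots> = 13 * ln 2 + 2 * ln (1 / \<alpha>)"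
  proof -
    have "ln (2 ^ 13 :: real) = 13 * ln 2" using ln_realpow[of 2 13] by simp
    moreover have "ln ((1 / \<alpha>)\<^sup>2) = 2 * ln (1 / \<alpha>)" using ln_realpow[of "1 / \<alpha>" 2] \<alpha> by simp
    ultimately show ?thesis using \<alpha> by (simp add: ln_mult_pos)
  qed
  also have "ln (1 / \<alpha>) = log 2 (1 / \<alpha>) * ln 2" using ln2 by (simp add: log_def)
  also have "13 * ln 2 + 2 * (log 2 (1 / \<alpha>) * ln 2) \<le> 15 * m * ln 2"
  proof -
    have "13 + 2 * log 2 (1 / \<alpha>) \<le> 15 * m" using m by linarith
    then have "(13 + 2 * log 2 (1 / \<alpha>)) * ln 2 \<le> 15 * m * ln 2" using ln2 by (intro mult_right_mono) auto
    then show ?thesis by (simp add: algebra_simps)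
  qed
  also have "\<dots> \<le> 15 * m" using ln2 m by (simp add: mult_left_le)
  finally have num: "ln (4 * n / k) \<le> 15 * m" .
  have "\<alpha> / 8 - (\<alpha> / 8)\<^sup>2 \<le> ln (1 + \<alpha> / 8)"
    using \<alpha> by (intro ln_one_plus_pos_lower_bound) auto
  moreover have "(\<alpha> / 8)\<^sup>2 \<le> \<alpha> / 8 * (1 / 2)"
    unfolding power2_eq_square using \<alpha> by (intro mult_left_mono) auto
  ultimately have den: "\<alpha> / 16 \<le> ln (1 + \<alpha> / 8)" by simp
  have "ln (4 * n / k) / ln (1 + \<alpha> / 8) \<le> 15 * m / ln (1 + \<alpha> / 8)"
    using num den \<alpha> by (intro divide_right_mono) auto
  also have "\<dots> \<le> 15 * m / (\<alpha> / 16)"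
    using den \<alpha> m by (intro divide_left_mono) auto
  finally have "2 * (ln (4 * n / k) / ln (1 + \<alpha> / 8)) \<le> 480 * m / \<alpha>" by simp
  moreover have "1 \<le> m / \<alpha>" using m \<alpha> by simp
  ultimately show ?thesis unfolding m_def[symmetric] by (simp add: add_divide_distrib)
qed

lemma circuit_lengths_lower_bound:
  fixes \<alpha> :: real
  assumes fin: "finite V" and sym: "symp E" and \<alpha>: "0 < \<alpha>" "\<alpha> \<le> 1"
    and exp: "\<And>U. U \<subseteq> V \<Longrightarrow> 2 * card U \<le> card V \<Longrightarrow> \<alpha> * card U \<le> card (nbrs E V U)"
    and n: "48 / \<alpha> \<le> card V"
  shows "1 / 2000000 * (\<alpha> ^ 3 / max 1 (log 2 (1 / \<alpha>))) * card V \<le> card (circuit_lengths E V)"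
proof -
  define m where "m = max 1 (log 2 (1 / \<alpha>))"
  have m: "1 \<le> m" by (simp add: m_def)
  have n48: "48 \<le> \<alpha> * card V" using n \<alpha> by (simp add: pos_divide_le_eq mult.commute)
  have "\<alpha> * card V \<le> card V" using \<alpha> by (simp add: mult_left_le_one_le)
  with n48 have V48: "48 \<le> card V" by linarith
  define \<gamma> where "\<gamma> = \<alpha> / 4"
  have \<gamma>: "0 < \<gamma>" "\<gamma> \<le> 1" using \<alpha> by (auto simp: \<gamma>_def)
  have exp': "\<gamma> * card U \<le> card (nbrs E V U)" if "U \<subseteq> V" "3 * card U \<le> 2 * card V" for U
    unfolding \<gamma>_def by (rule expansion_large[OF fin sym \<alpha> exp that])
  \<comment> \<open>The largest size allowed by 12 p \<le> \<gamma> |V| with \<gamma> = \<alpha>/4.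
    As \<alpha> |V| \<ge> 48, rounding down costs at most a factor 2.\<close>
  define p where "p = nat \<lfloor>\<alpha> * card V / 48\<rfloor>"
  have p: "p \<le> \<alpha> * card V / 48" "\<alpha> * card V / 96 \<le> p"
  proof -
    have "1 \<le> \<lfloor>\<alpha> * card V / 48\<rfloor>" using n48 by (simp add: le_floor_iff)
    moreover from this have "real p = of_int \<lfloor>\<alpha> * card V / 48\<rfloor>" by (simp add: p_def)
    ultimately show "p \<le> \<alpha> * card V / 48" "\<alpha> * card V / 96 \<le> p" by linarith+
  qed
  \<comment> \<open>With half of the vertices finished, the stack contains all their outside
    neighbours, at least \<alpha> |V|/4 of them, and can be cut to \<open>p\<close>
    vertices.\<close>
  have "card V div 2 \<le> card V" by simp
  from dfs_path[OF fin this sym] obtain S ys where S: "S \<subseteq> V" "card S = card V div 2"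
    and ys: "distinct ys" "set ys \<subseteq> V - S" "successively E ys" "nbrs E V S \<subseteq> set ys" by blast
  have "card V / 4 \<le> card S" using V48 S(2) by linarith
  then have "\<alpha> * (card V / 4) \<le> \<alpha> * card S" using \<alpha> by (intro mult_left_mono) auto
  also have "\<dots> \<le> card (nbrs E V S)" by (intro exp S(1)) (simp add: S(2))
  also have "\<dots> \<le> length ys"
    using card_mono[OF _ ys(4)] card_length[of ys] by (simp add: le_trans)
  finally have "p \<le> length ys" using p(1) n48 by linarith
  define xs where "xs = take p ys"
  have xs: "distinct xs" "successively E xs" "set xs \<subseteq> V" "card (set xs) = p"
  proof -
    show "distinct xs" using ys by (simp add: xs_def)
    then show "card (set xs) = p" using \<open>p \<le> length ys\<close> by (simp add: distinct_card xs_def)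
    show "set xs \<subseteq> V" using ys set_take_subset[of p ys] by (auto simp: xs_def)
    show "successively E xs" using ys unfolding xs_def
      by (metis append_take_drop_id successively_append_iff)
  qed
  have pV: "12 * card (set xs) \<le> \<gamma> * card V" using p(1) xs(4) by (simp add: \<gamma>_def)
  obtain Z where Z: "Z \<subseteq> V - set xs" "card (nbrs E (V - set xs) Z) \<le> \<gamma> / 2 * card Z"
    "6 * card Z \<le> card V"
    and expW: "\<And>A. A \<subseteq> V - set xs - Z \<Longrightarrow> 2 * card A \<le> card V \<Longrightarrow>
      \<gamma> / 2 * card A \<le> card (nbrs E (V - set xs - Z) A)"
    using maximal_nonexpanding_set[OF fin \<gamma>(1) exp' xs(3) pV] by blast
  obtain M where M: "M \<subseteq> set xs \<times> (V - set xs - Z)" "\<And>x y. (x, y) \<in> M \<Longrightarrow> E x y"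
    "inj_on fst M" "inj_on snd M" "\<gamma> * card (set xs) \<le> 3 * card M"
    using large_matching[OF fin \<gamma> exp' xs(3) pV Z] by blast
  \<comment> \<open>1152 = 4 * 3 * 96, from \<gamma> = \<alpha>/4, the matching bound and the length
    of the path.\<close>
  have "\<alpha> * (\<alpha> * card V / 96) \<le> \<alpha> * p" using p(2) \<alpha> by (intro mult_left_mono) auto
  then have k: "\<alpha>\<^sup>2 * card V / 1152 \<le> card M"
    using M(5) xs(4) by (simp add: \<gamma>_def power2_eq_square)
  have target: "1 / 2000000 * (\<alpha> ^ 3 / m) * card V = \<alpha>\<^sup>2 * card V / 2000000 * (\<alpha> / m)"
    by (simp add: power2_eq_square power3_eq_cube)
  have \<alpha>m: "0 < \<alpha> / m" "\<alpha> / m \<le> 1" using \<alpha> m by auto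
  show ?thesis
  proof (cases "4 \<le> card M")
    case True
    let ?f = "2 * (ln (4 * real (card V) / card M) / ln (1 + \<alpha> / 8)) + 1"
    have "card M / 2 \<le> card (circuit_lengths E V) * ?f"
      using many_circuit_lengths[OF fin sym _ _ expW xs(1,2) _ M(1-4) True] xs(3) \<gamma>
      by (auto simp: \<gamma>_def)
    also have "\<dots> \<le> card (circuit_lengths E V) * (481 * m / \<alpha>)"
    proof (rule mult_left_mono)
      show "?f \<le> 481 * m / \<alpha>"
        unfolding m_def by (rule level_count_bound[OF \<alpha> _ k]) (use V48 in simp)
    qed simp
    finally have "card M / 2 * (\<alpha> / m) \<le> card (circuit_lengths E V) * (481 * m / \<alpha>) * (\<alpha> / m)"
      using \<alpha>m by (intro mult_right_mono) auto
    then have 1: "card M / 2 * (\<alpha> / m) \<le> 481 * card (circuit_lengths E V)"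
      using \<alpha> m by (simp add: field_simps)
    \<comment> \<open>Here 2 * 481 * 1152 < 2000000.\<close>
    have "\<alpha>\<^sup>2 * card V / 2000000 \<le> card M / 2 / 481" using k of_nat_0_le_iff[of "card M"] by linarith
    then have "\<alpha>\<^sup>2 * card V / 2000000 * (\<alpha> / m) \<le> card M / 2 / 481 * (\<alpha> / m)"
      using \<alpha>m by (intro mult_right_mono) auto
    with 1 show ?thesis unfolding m_def[symmetric] target by simp
  next
    case False
    \<comment> \<open>Now \<alpha>^2 |V| < 4 * 1152, so the claimed bound is at most 1 and one cycle
      suffices.\<close>
    then have "\<alpha>\<^sup>2 * card V / 2000000 \<le> 1" using k by linarith
    then have "\<alpha>\<^sup>2 * card V / 2000000 * (\<alpha> / m) \<le> 1 * 1" using \<alpha>m by (intro mult_mono) auto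
    moreover have "circuit_lengths E V \<noteq> {}"
      by (rule circuit_exists[OF fin sym \<alpha> exp]) (use n48 \<alpha> in \<open>auto simp: pos_divide_le_eq mult.commute\<close>)
    then have "1 \<le> card (circuit_lengths E V)"
      using finite_circuit_lengths[OF fin] by (simp add: Suc_le_eq card_gt_0_iff)
    ultimately show ?thesis unfolding m_def[symmetric] target by simp
  qed
qed

text \<open>A path with an even number n of vertices is a 2/n-expander without cycles, so n has to
  exceed a multiple of 1/\<alpha>. The maximum with 1 is there because the logarithm vanishes at
  \<alpha> = 1.\<close>

theorem theorem2:
  shows "\<exists>c>0. \<exists>C>0. \<forall>(\<alpha>::real) (G :: ('v, 'e) pre_digraph).
           0 < \<alpha> \<and> \<alpha> \<le> 1 \<and> graph G \<and> alpha_expander \<alpha> G \<and> real (card (verts G)) \<ge> C / \<alpha> \<longrightarrow>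
           real (card (cycle_lengths G)) \<ge>
             c * (\<alpha> ^ 3 / max 1 (log 2 (1 / \<alpha>))) * real (card (verts G))"
proof (rule exI[of _ "1 / 2000000 :: real"], intro exI[of _ "48 :: real"] conjI allI impI)
  fix \<alpha> :: real and G :: "('v, 'e) pre_digraph"
  assume "0 < \<alpha> \<and> \<alpha> \<le> 1 \<and> graph G \<and> alpha_expander \<alpha> G \<and> real (card (verts G)) \<ge> 48 / \<alpha>"
  then have \<alpha>: "0 < \<alpha>" "\<alpha> \<le> 1" and G: "graph G" and exp: "alpha_expander \<alpha> G"
    and n: "48 / \<alpha> \<le> card (verts G)" by auto
  interpret graph G by (rule G)
  let ?E = "\<lambda>u v. u \<rightarrow>\<^bsub>G\<^esub> v"
  have sym: "symp ?E" using sym_arcs by (auto simp: symmetric_def sym_def symp_def)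
  have "1 / 2000000 * (\<alpha> ^ 3 / max 1 (log 2 (1 / \<alpha>))) * card (verts G)
      \<le> card (circuit_lengths ?E (verts G))"
  proof (rule circuit_lengths_lower_bound[OF finite_verts sym \<alpha> _ n])
    fix U assume U: "U \<subseteq> verts G" "2 * card U \<le> card (verts G)"
    then have "int (card U) \<le> \<lceil>real (card (verts G)) / 2\<rceil>" by linarith
    with exp U(1) have "\<alpha> * card U \<le> card (ext_neighborhood G U)" by (simp add: alpha_expander_def)
    then show "\<alpha> * card U \<le> card (nbrs ?E (verts G) U)"
      by (simp add: ext_neighborhood_def nbrs_def)
  qed
  also have "card (circuit_lengths ?E (verts G)) \<le> card (cycle_lengths G)"
    by (intro card_mono finite_cycle_lengths circuit_lengths_subset_cycle_lengths)
  finally show "1 / 2000000 * (\<alpha> ^ 3 / max 1 (log 2 (1 / \<alpha>))) * real (card (verts G))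
      \<le> real (card (cycle_lengths G))" by simp
qed auto

end
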